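(* Let $P$ be the discrete-time Poisson channel under an average power constraint $E>0$. For every $\lambda_1,\lambda_2>0$ with $\lambda_1+\lambda_2<1$, \[ \frac14\le\dot{C}_{\mathrm{DI}}(P)\le\limsup_{n\to\infty}\frac{1}{n\log n}\log N_{\mathrm{DI}}(n,\lambda_1,\lambda_2)\le\frac12. \]
   Context: The Poisson channel maps $x\in\mathbb{R}_{\ge0}$ to the distribution $P_x(y)=e^{-x}x^y/y!$ on $y\in\mathbb{N}_0$; $P_{x^n}(y^n)=\prod_iP_{x_i}(y_i)$. Under average power constraint $E>0$, an $(n,N,\lambda_1,\lambda_2)$-DI code is a family $\{(u_j,\mathcal{E}_j):j\in[N]\}$ with $u_j=x^n\in\mathbb{R}_{\ge0}^n$ satisfying $\sum_{i=1}^nx_i\le nE$, and $\mathcal{E}_j\subset\mathbb{N}_0^n$, such that $P_{u_j}(\mathcal{E}_j)\ge1-\lambda_1$ for all $j$ and $P_{u_j}(\mathcal{E}_k)\le\lambda_2$ for $j\ne k$; $N_{\mathrm{DI}}(n,\lambda_1,\lambda_2)$ is the largest such $N$. Logarithms base 2; $\dot{C}_{\mathrm{DI}}(P)=\inf_{\lambda_1,\lambda_2>0}\liminf_{n\to\infty}\frac{1}{n\log n}\log N_{\mathrm{DI}}(n,\lambda_1,\lambda_2)$. *)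

theory Defs
  imports "HOL-Probability.Probability"
begin

(* Poisson channel output distribution for input x >= 0.
   For x = 0 this is the point mass at 0 (= e^0 0^y / y!, with 0^0 = 1). *)
definition poisson_out :: "real \<Rightarrow> nat pmf" where
  "poisson_out x = (if 0 < x then poisson_pmf x else return_pmf 0)"

(* Memoryless extension P_{x^n}: output sequences y^n are functions nat => nat
   that are 0 outside {..<n}. *)
definition poisson_prod :: "nat \<Rightarrow> (nat \<Rightarrow> real) \<Rightarrow> (nat \<Rightarrow> nat) pmf" where
  "poisson_prod n x = Pi_pmf {..<n} 0 (\<lambda>i. poisson_out (x i))"

definition is_DI_code ::
  "real \<Rightarrow> nat \<Rightarrow> nat \<Rightarrow> real \<Rightarrow> real \<Rightarrow> (nat \<Rightarrow> nat \<Rightarrow> real) \<Rightarrow> (nat \<Rightarrow> (nat \<Rightarrow> nat) set) \<Rightarrow> bool"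
where
  "is_DI_code E n N l1 l2 u D \<longleftrightarrow>
     (\<forall>j<N. (\<forall>i<n. 0 \<le> u j i) \<and> (\<Sum>i<n. u j i) \<le> real n * E) \<and>
     (\<forall>j<N. measure_pmf.prob (poisson_prod n (u j)) (D j) \<ge> 1 - l1) \<and>
     (\<forall>j<N. \<forall>k<N. j \<noteq> k \<longrightarrow> measure_pmf.prob (poisson_prod n (u j)) (D k) \<le> l2)"

(* N_DI(n, l1, l2): the largest code size, as an extended real (may be infinite
   a priori, e.g. when l1 >= 1). *)
definition N_DI :: "real \<Rightarrow> nat \<Rightarrow> real \<Rightarrow> real \<Rightarrow> ereal" where
  "N_DI E n l1 l2 = Sup {ereal (real N) | N. \<exists>u D. is_DI_code E n N l1 l2 u D}"

definition elog2 :: "ereal \<Rightarrow> ereal" where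
  "elog2 z = (if z = \<infinity> then \<infinity> else ereal (log 2 (real_of_ereal z)))"

definition DI_rate :: "real \<Rightarrow> real \<Rightarrow> real \<Rightarrow> nat \<Rightarrow> ereal" where
  "DI_rate E l1 l2 n = elog2 (N_DI E n l1 l2) * ereal (1 / (real n * log 2 (real n)))"

definition C_DI_dot :: "real \<Rightarrow> ereal" where
  "C_DI_dot E = (INF l\<in>{l::real \<times> real. 0 < fst l \<and> 0 < snd l}.
                   liminf (DI_rate E (fst l) (snd l)))"

end

theory Submission
  imports Defs "HOL-Real_Asymp.Real_Asymp"
begin

text \<open>
  Upper bound: distinguishable inputs must be far apart in the Hellinger sense. The Bhattacharyya
  coefficient of two Poisson products is \<open>exp (- \<Sum>(\<surd>x\<^sub>i - \<surd>y\<^sub>i)\<^sup>2 / 2)\<close>, so the vectors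
  \<open>\<surd>u\<^sub>j\<close> have pairwise Euclidean distance bounded below by a constant. Rounding them to a grid of
  mesh of order \<open>1/\<surd>n\<close> is therefore injective, and the image consists of nonnegative integer vectors
  with coordinate sum \<open>O(n\<surd>n)\<close>, of which there are \<open>n powr (n/2 + o(n))\<close>.

  Lower bound: inputs with coordinates on a grid in \<open>[0, E]\<close> of mesh of order
  \<open>n powr (-1/4)\<close>, chosen by the Gilbert-Varshamov argument to differ pairwise in at least
  \<open>\<epsilon> n\<close> positions, have squared distance at least of order \<open>\<surd>n\<close>. The statistic
  \<open>\<Sum>((y\<^sub>i - a\<^sub>i)\<^sup>2 - y\<^sub>i)\<close> is an unbiased estimator of the squared distance of the true input
  to \<open>a\<close> with standard deviation \<open>O(\<surd>n)\<close>, so by Chebyshev it identifies the codeword \<open>a\<close>. There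
  are \<open>n powr ((1 - \<epsilon>) n / 4 - O(n / log n))\<close> such codewords.
\<close>

section \<open>Second moments under product distributions\<close>

text \<open>Centring and independence kill the off-diagonal products, so only the variances survive.
  Independence also yields integrability of those products from first moments alone.\<close>

lemma expectation_sum_square_Pi_pmf:
  fixes g :: "'i \<Rightarrow> 'b \<Rightarrow> real"
  assumes "finite A"
    and int: "\<And>i. i \<in> A \<Longrightarrow> integrable (measure_pmf (p i)) (g i)"
    and int2: "\<And>i. i \<in> A \<Longrightarrow> integrable (measure_pmf (p i)) (\<lambda>v. (g i v)\<^sup>2)"
    and mean: "\<And>i. i \<in> A \<Longrightarrow> measure_pmf.expectation (p i) (g i) = 0"
  shows "integrable (measure_pmf (Pi_pmf A d p)) (\<lambda>y. (\<Sum>i\<in>A. g i (y i))\<^sup>2)"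
    and "measure_pmf.expectation (Pi_pmf A d p) (\<lambda>y. (\<Sum>i\<in>A. g i (y i))\<^sup>2) =
           (\<Sum>i\<in>A. measure_pmf.expectation (p i) (\<lambda>v. (g i v)\<^sup>2))"
proof -
  let ?M = "measure_pmf (Pi_pmf A d p)"
  have component: "measure_pmf.expectation (p i) f = measure_pmf.expectation (Pi_pmf A d p) (\<lambda>y. f (y i))"
       "integrable (measure_pmf (p i)) f \<longleftrightarrow> integrable ?M (\<lambda>y. f (y i))"
    if "i \<in> A" for i and f :: "'b \<Rightarrow> real"
  proof -
    have "p i = map_pmf (\<lambda>y. y i) (Pi_pmf A d p)"
      using that assms(1) by (simp add: Pi_pmf_component)
    then show "measure_pmf.expectation (p i) f = measure_pmf.expectation (Pi_pmf A d p) (\<lambda>y. f (y i))"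
       "integrable (measure_pmf (p i)) f \<longleftrightarrow> integrable ?M (\<lambda>y. f (y i))"
      by simp_all
  qed
  have indep: "prob_space.indep_vars ?M (\<lambda>_. borel) (\<lambda>i y. g i (y i)) A"
    by (rule prob_space.indep_vars_compose2[OF measure_pmf.prob_space_axioms indep_vars_Pi_pmf[OF assms(1)]]) simp
  have cross: "integrable ?M (\<lambda>y. g i (y i) * g j (y j)) \<and>
      (\<integral>y. g i (y i) * g j (y j) \<partial>?M) = (if i = j then measure_pmf.expectation (p i) (\<lambda>v. (g i v)\<^sup>2) else 0)"
    if ij: "i \<in> A" "j \<in> A" for i j
  proof (cases "i = j")
    case True
    then show ?thesis
      using component(1)[OF ij(1), of "\<lambda>v. (g i v)\<^sup>2"] component(2)[OF ij(1), of "\<lambda>v. (g i v)\<^sup>2"] int2[OF ij(1)]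
      by (simp add: power2_eq_square)
  next
    case False
    have ind: "prob_space.indep_vars ?M (\<lambda>_. borel) (\<lambda>i y. g i (y i)) {i, j}"
      by (rule prob_space.indep_vars_subset[OF measure_pmf.prob_space_axioms indep]) (use ij in auto)
    have *: "integrable ?M (\<lambda>y. g k (y k))" "(\<integral>y. g k (y k) \<partial>?M) = 0" if "k \<in> {i, j}" for k
      using that ij component[of k "g k"] int[of k] mean[of k] by auto
    show ?thesis
      using prob_space.indep_vars_lebesgue_integral[OF measure_pmf.prob_space_axioms _ ind]
        prob_space.indep_vars_integrable[OF measure_pmf.prob_space_axioms _ ind] * False
      by simp
  qed
  have expand: "(\<Sum>i\<in>A. g i (y i))\<^sup>2 = (\<Sum>i\<in>A. \<Sum>j\<in>A. g i (y i) * g j (y j))" for y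
    by (simp add: power2_eq_square sum_product)
  show "integrable ?M (\<lambda>y. (\<Sum>i\<in>A. g i (y i))\<^sup>2)"
    unfolding expand using cross by (intro Bochner_Integration.integrable_sum) auto
  have "(\<integral>y. (\<Sum>i\<in>A. g i (y i))\<^sup>2 \<partial>?M) = (\<Sum>i\<in>A. \<Sum>j\<in>A. \<integral>y. g i (y i) * g j (y j) \<partial>?M)"
    unfolding expand using cross
    by (subst Bochner_Integration.integral_sum; (intro Bochner_Integration.integrable_sum)?; simp)+
  also have "\<dots> = (\<Sum>i\<in>A. \<Sum>j\<in>A. if i = j then measure_pmf.expectation (p i) (\<lambda>v. (g i v)\<^sup>2) else 0)"
    by (intro sum.cong refl) (use cross in auto)
  also have "\<dots> = (\<Sum>i\<in>A. measure_pmf.expectation (p i) (\<lambda>v. (g i v)\<^sup>2))"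
    using assms(1) by simp
  finally show "(\<integral>y. (\<Sum>i\<in>A. g i (y i))\<^sup>2 \<partial>?M) = (\<Sum>i\<in>A. measure_pmf.expectation (p i) (\<lambda>v. (g i v)\<^sup>2))" .
qed

lemma measure_pmf_Chebyshev:
  fixes f :: "'a \<Rightarrow> real"
  assumes "integrable (measure_pmf p) (\<lambda>y. (f y)\<^sup>2)" "0 < t" "measure_pmf.expectation p (\<lambda>y. (f y)\<^sup>2) \<le> V"
  shows "measure_pmf.prob p {y. t \<le> \<bar>f y\<bar>} \<le> V / t\<^sup>2"
proof -
  have "measure_pmf.prob p {y. t \<le> \<bar>f y\<bar>} = measure_pmf.prob p {y \<in> space (measure_pmf p). t\<^sup>2 \<le> (f y)\<^sup>2}"
    using assms(2) abs_le_square_iff[of t] by (intro arg_cong[where f = "measure_pmf.prob p"]) auto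
  also have "\<dots> \<le> measure_pmf.expectation p (\<lambda>y. (f y)\<^sup>2) / t\<^sup>2"
    by (rule integral_Markov_inequality_measure[where A = "{}"]) (use assms in auto)
  also have "\<dots> \<le> V / t\<^sup>2"
    using assms by (simp add: divide_right_mono)
  finally show ?thesis .
qed

section \<open>Moments of the Poisson channel\<close>

text \<open>The convention 0^0 = 1 lets one formula cover the point mass at \<open>x = 0\<close>
  too, so that later computations need no case split.\<close>

lemma pmf_poisson_out:
  assumes "0 \<le> x"
  shows "pmf (poisson_out x) k = x ^ k / fact k * exp (- x)"
  using assms by (cases "k = 0") (auto simp: poisson_out_def power_0_left)

lemma poisson_out_integral:
  fixes f :: "nat \<Rightarrow> real"
  assumes "0 \<le> x" "summable (\<lambda>k. x ^ k / fact k * exp (- x) * \<bar>f k\<bar>)"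
    "(\<lambda>k. x ^ k / fact k * exp (- x) * f k) sums S"
  shows "integrable (measure_pmf (poisson_out x)) f"
    and "measure_pmf.expectation (poisson_out x) f = S"
proof -
  have *: "integrable (count_space UNIV) (\<lambda>k. pmf (poisson_out x) k * f k)"
    using assms by (simp add: integrable_count_space_nat_iff pmf_poisson_out abs_mult)
  then show "integrable (measure_pmf (poisson_out x)) f"
    unfolding measure_pmf_eq_density by (subst integrable_density) auto
  have "measure_pmf.expectation (poisson_out x) f = (\<integral>k. pmf (poisson_out x) k * f k \<partial>count_space UNIV)"
    unfolding measure_pmf_eq_density by (subst integral_density) auto
  also have "\<dots> = S"
    using * assms by (subst integral_count_space_nat) (simp_all add: sums_iff pmf_poisson_out)
  finally show "measure_pmf.expectation (poisson_out x) f = S" .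
qed

lemma exp_sums: "(\<lambda>k. x ^ k / fact k) sums exp (x::real)"
  using exp_converges[of x] by (simp add: scaleR_conv_of_real field_simps)

text \<open>The probability generating function. At \<open>z = exp 2\<close> it supplies the
  exponential moment that dominates the test statistic.\<close>

lemma poisson_out_power:
  assumes "0 \<le> x" "0 \<le> z"
  shows "integrable (measure_pmf (poisson_out x)) (\<lambda>k. z ^ k)"
    and "measure_pmf.expectation (poisson_out x) (\<lambda>k. z ^ k) = exp (x * (z - 1))"
proof -
  have "(\<lambda>k. (x * z) ^ k / fact k * exp (- x)) sums (exp (x * z) * exp (- x))"
    by (intro sums_mult2 exp_sums)
  also have "exp (x * z) * exp (- x) = exp (x * (z - 1))"
    by (simp add: mult_exp_exp algebra_simps)
  also have "(\<lambda>k. (x * z) ^ k / fact k * exp (- x)) = (\<lambda>k. x ^ k / fact k * exp (- x) * z ^ k)"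
    by (simp add: power_mult_distrib mult_ac)
  finally have *: "(\<lambda>k. x ^ k / fact k * exp (- x) * z ^ k) sums exp (x * (z - 1))" .
  show "integrable (measure_pmf (poisson_out x)) (\<lambda>k. z ^ k)"
       "measure_pmf.expectation (poisson_out x) (\<lambda>k. z ^ k) = exp (x * (z - 1))"
    using poisson_out_integral[OF assms(1) _ *] assms * by (auto simp: sums_iff)
qed

text \<open>Falling factorials fit the Poisson weights:
  \<open>x * ?w k = ?w (Suc k) * real (Suc k)\<close>, so each moment series is the previous one
  with its index shifted, the new term at 0 being zero.\<close>

lemma poisson_out_falling_moments:
  assumes "0 \<le> x"
  shows "integrable (measure_pmf (poisson_out x)) (\<lambda>k. real k)"
    and "measure_pmf.expectation (poisson_out x) (\<lambda>k. real k) = x"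
    and "integrable (measure_pmf (poisson_out x)) (\<lambda>k. real k * (real k - 1))"
    and "measure_pmf.expectation (poisson_out x) (\<lambda>k. real k * (real k - 1)) = x\<^sup>2"
proof -
  let ?w = "\<lambda>k. x ^ k / fact k * exp (- x)"
  have w: "?w sums 1"
    using sums_mult2[OF exp_sums[of x], of "exp (- x)"] by (simp add: mult_exp_exp)
  have "(\<lambda>k. x * ?w k) sums (x * 1)"
    by (rule sums_mult[OF w])
  also have "(\<lambda>k. x * ?w k) = (\<lambda>k. ?w (Suc k) * real (Suc k))"
    by (simp add: fun_eq_iff field_simps del: of_nat_Suc)
  finally have 1: "(\<lambda>k. ?w k * real k) sums x"
    by (subst (asm) sums_Suc_iff) simp
  have "(\<lambda>k. x * (?w k * real k)) sums (x * x)"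
    by (rule sums_mult[OF 1])
  also have "(\<lambda>k. x * (?w k * real k)) = (\<lambda>k. ?w (Suc k) * (real (Suc k) * (real (Suc k) - 1)))"
    by (simp add: fun_eq_iff divide_simps)
  finally have 2: "(\<lambda>k. ?w k * (real k * (real k - 1))) sums x\<^sup>2"
    by (subst (asm) sums_Suc_iff) (simp add: power2_eq_square)
  have nonneg: "0 \<le> real k * (real k - 1)" for k
    by (cases k) auto
  show "integrable (measure_pmf (poisson_out x)) (\<lambda>k. real k)"
     "measure_pmf.expectation (poisson_out x) (\<lambda>k. real k) = x"
    using poisson_out_integral[OF assms _ 1] 1 by (auto simp: sums_iff)
  show "integrable (measure_pmf (poisson_out x)) (\<lambda>k. real k * (real k - 1))"
    "measure_pmf.expectation (poisson_out x) (\<lambda>k. real k * (real k - 1)) = x\<^sup>2"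
    using poisson_out_integral[OF assms _ 2] 2 nonneg by (auto simp: sums_iff)
qed

text \<open>A Poisson variable has variance equal to its mean, so subtracting \<open>real k\<close>
  removes exactly the bias \<open>x\<close> of \<open>(real k - a)^2\<close>.\<close>

lemma poisson_out_squared_distance:
  assumes "0 \<le> x"
  shows "integrable (measure_pmf (poisson_out x)) (\<lambda>k. (real k - a)\<^sup>2 - real k)"
    and "measure_pmf.expectation (poisson_out x) (\<lambda>k. (real k - a)\<^sup>2 - real k) = (x - a)\<^sup>2"
proof -
  note m = poisson_out_falling_moments[OF assms]
  have eq: "(real k - a)\<^sup>2 - real k = real k * (real k - 1) - 2 * a * real k + a\<^sup>2" for k
    by (simp add: power2_eq_square algebra_simps)
  show "integrable (measure_pmf (poisson_out x)) (\<lambda>k. (real k - a)\<^sup>2 - real k)"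
    unfolding eq using m by auto
  show "measure_pmf.expectation (poisson_out x) (\<lambda>k. (real k - a)\<^sup>2 - real k) = (x - a)\<^sup>2"
    unfolding eq by (subst Bochner_Integration.integral_add Bochner_Integration.integral_diff;
        use m in \<open>simp add: power2_diff\<close>)+
qed

text \<open>A crude bound suffices, as long as it is uniform over inputs and centres in [0, E]: the
  polynomial in \<open>k\<close> is dominated by a multiple of \<open>exp (2 k)\<close>.\<close>

lemma poisson_out_squared_distance_variance:
  assumes "0 \<le> x" "x \<le> E" "0 \<le> a" "a \<le> E"
  shows "integrable (measure_pmf (poisson_out x)) (\<lambda>k. ((real k - a)\<^sup>2 - real k - (x - a)\<^sup>2)\<^sup>2)"
    and "measure_pmf.expectation (poisson_out x) (\<lambda>k. ((real k - a)\<^sup>2 - real k - (x - a)\<^sup>2)\<^sup>2)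
           \<le> (3 + 2 * E\<^sup>2)\<^sup>2 * exp (E * (exp 2 - 1))"
proof -
  let ?B = "(3 + 2 * E\<^sup>2)\<^sup>2"
  let ?f = "\<lambda>k. ((real k - a)\<^sup>2 - real k - (x - a)\<^sup>2)\<^sup>2"
  have bound: "?f k \<le> ?B * exp 2 ^ k" for k
  proof -
    have e: "1 + real k + real k ^ 2 / 2 \<le> exp (real k)"
      by (rule exp_lower_Taylor_quadratic) simp
    have "(real k - a)\<^sup>2 \<le> (real k)\<^sup>2 + a\<^sup>2"
      using assms by (simp add: power2_diff)
    moreover have "a\<^sup>2 \<le> E\<^sup>2" "(x - a)\<^sup>2 \<le> E\<^sup>2"
      using assms by (auto simp flip: abs_le_square_iff)
    moreover have "0 \<le> (real k - a)\<^sup>2" "0 \<le> (x - a)\<^sup>2" "0 \<le> E\<^sup>2" by simp_all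
    ultimately have "\<bar>(real k - a)\<^sup>2 - real k - (x - a)\<^sup>2\<bar> \<le> (real k)\<^sup>2 + real k + 2 * E\<^sup>2"
      by linarith
    also have "\<dots> \<le> 3 * exp (real k) + 2 * E\<^sup>2 * 1"
    proof -
      have "0 \<le> (real k)\<^sup>2" by simp
      then show ?thesis using e by linarith
    qed
    also have "\<dots> \<le> 3 * exp (real k) + 2 * E\<^sup>2 * exp (real k)"
      by (intro add_left_mono mult_left_mono) auto
    also have "\<dots> = (3 + 2 * E\<^sup>2) * exp (real k)"
      by (simp add: algebra_simps)
    finally have "?f k \<le> ((3 + 2 * E\<^sup>2) * exp (real k))\<^sup>2"
      by (intro abs_le_square_iff[THEN iffD1]) simp
    also have "\<dots> = ?B * exp 2 ^ k"
      by (simp add: power_mult_distrib flip: exp_of_nat_mult exp_double)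
    finally show ?thesis .
  qed
  note pw = poisson_out_power[OF assms(1), of "exp 2"]
  show int: "integrable (measure_pmf (poisson_out x)) ?f"
    by (rule Bochner_Integration.integrable_bound[of _ "\<lambda>k. ?B * exp 2 ^ k"]) (use pw bound in auto)
  have "measure_pmf.expectation (poisson_out x) ?f \<le> measure_pmf.expectation (poisson_out x) (\<lambda>k. ?B * exp 2 ^ k)"
    using pw bound int by (intro integral_mono) auto
  also have "\<dots> = ?B * exp (x * (exp 2 - 1))"
    using pw by simp
  also have "\<dots> \<le> ?B * exp (E * (exp 2 - 1))"
    using assms by (intro mult_left_mono exp_le_cancel_iff[THEN iffD2] mult_right_mono) auto
  finally show "measure_pmf.expectation (poisson_out x) ?f \<le> ?B * exp (E * (exp 2 - 1))" .
qed

section \<open>The Bhattacharyya coefficient\<close>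

text \<open>This is the affinity, the sum of \<open>sqrt (pmf p y * pmf q y)\<close>; points with
  \<open>pmf q y = 0\<close> contribute 0 to both forms. As an expectation under \<open>q\<close> it
  factorises over product measures.\<close>

definition bhattacharyya :: "'a pmf \<Rightarrow> 'a pmf \<Rightarrow> real" where
  "bhattacharyya p q = measure_pmf.expectation q (\<lambda>y. sqrt (pmf p y / pmf q y))"

text \<open>Equality can fail: the mass that \<open>p\<close> puts on points where \<open>q\<close>
  vanishes is lost.\<close>

lemma nn_integral_likelihood_ratio_le:
  "(\<integral>\<^sup>+y. ennreal (pmf p y / pmf q y) * indicator A y \<partial>measure_pmf q) \<le> emeasure (measure_pmf p) A"
proof -
  have "(\<integral>\<^sup>+y. ennreal (pmf p y / pmf q y) * indicator A y \<partial>measure_pmf q)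
      = (\<integral>\<^sup>+y. ennreal (pmf q y) * (ennreal (pmf p y / pmf q y) * indicator A y) \<partial>count_space UNIV)"
    by (rule nn_integral_measure_pmf)
  also have "\<dots> \<le> (\<integral>\<^sup>+y. ennreal (pmf p y) * indicator A y \<partial>count_space UNIV)"
    by (intro nn_integral_mono) (auto simp: indicator_def simp flip: ennreal_mult')
  also have "\<dots> = emeasure (measure_pmf p) A"
    by (simp flip: nn_integral_measure_pmf)
  finally show ?thesis .
qed

lemma integrable_likelihood_ratio:
  "integrable (measure_pmf q) (\<lambda>y. pmf p y / pmf q y)"
proof (rule integrableI_bounded)
  have "(\<integral>\<^sup>+y. ennreal (norm (pmf p y / pmf q y)) \<partial>measure_pmf q) \<le> emeasure (measure_pmf p) UNIV"
    using nn_integral_likelihood_ratio_le[of q p UNIV] by simp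
  then show "(\<integral>\<^sup>+y. ennreal (norm (pmf p y / pmf q y)) \<partial>measure_pmf q) < \<infinity>"
    using measure_pmf.emeasure_space_1[of p] by (auto intro: le_less_trans)
qed simp

lemma expectation_likelihood_ratio_le:
  "measure_pmf.expectation q (\<lambda>y. pmf p y / pmf q y * indicator A y) \<le> measure_pmf.prob p A"
proof -
  have int: "integrable (measure_pmf q) (\<lambda>y. pmf p y / pmf q y * indicator A y)"
    by (rule Bochner_Integration.integrable_bound[OF integrable_likelihood_ratio[of q p]])
       (auto simp: indicator_def)
  have "ennreal (measure_pmf.expectation q (\<lambda>y. pmf p y / pmf q y * indicator A y))
      = (\<integral>\<^sup>+y. ennreal (pmf p y / pmf q y * indicator A y) \<partial>measure_pmf q)"
    by (intro nn_integral_eq_integral[symmetric] int) simp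
  also have "\<dots> = (\<integral>\<^sup>+y. ennreal (pmf p y / pmf q y) * indicator A y \<partial>measure_pmf q)"
    by (intro nn_integral_cong) (auto simp: indicator_def)
  also have "\<dots> \<le> ennreal (measure_pmf.prob p A)"
    using nn_integral_likelihood_ratio_le[of q p A] by (simp add: measure_pmf.emeasure_eq_measure)
  finally show ?thesis by (simp add: measure_nonneg)
qed

lemma integrable_sqrt_likelihood_ratio:
  "integrable (measure_pmf q) (\<lambda>y. sqrt (pmf p y / pmf q y))"
proof (rule Bochner_Integration.integrable_bound)
  show "integrable (measure_pmf q) (\<lambda>y. 1 + pmf p y / pmf q y)"
    by (intro Bochner_Integration.integrable_add integrable_likelihood_ratio) simp
  have "sqrt t \<le> 1 + t" if "0 \<le> t" for t :: real
    using that by (intro real_le_lsqrt) (auto simp: power2_sum)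
  then show "AE y in measure_pmf q. norm (sqrt (pmf p y / pmf q y)) \<le> norm (1 + pmf p y / pmf q y)"
    by simp
qed simp

text \<open>
  With \<open>F\<close> the square root of the likelihood ratio, the difference of the probabilities is at most
  the \<open>q\<close>-integral of \<open>1 - F\<^sup>2\<close> over the complement of \<open>D\<close>, and
  \<open>1 - F\<^sup>2 \<le> t / 2 + 2 (1 - F)\<^sup>2 / t\<close> pointwise. Passing to the complement makes absolute
  continuity unnecessary.
\<close>

lemma bhattacharyya_le_of_prob_diff:
  assumes "0 < t" "t \<le> measure_pmf.prob p D - measure_pmf.prob q D"
  shows "t\<^sup>2 / 4 \<le> 2 - 2 * bhattacharyya p q"
proof -
  define F where "F y = sqrt (pmf p y / pmf q y)" for y
  have sq: "(F y)\<^sup>2 = pmf p y / pmf q y" and F0: "0 \<le> F y" for y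
    by (simp_all add: F_def)
  have F1: "integrable (measure_pmf q) F"
    unfolding F_def by (rule integrable_sqrt_likelihood_ratio)
  have F2: "integrable (measure_pmf q) (\<lambda>y. (F y)\<^sup>2)"
    unfolding sq by (rule integrable_likelihood_ratio)
  have le1: "measure_pmf.expectation q (\<lambda>y. (F y)\<^sup>2) \<le> 1"
    using expectation_likelihood_ratio_le[of q p UNIV] by (simp add: sq)
  have int2: "integrable (measure_pmf q) (\<lambda>y. (F y)\<^sup>2 * indicator (- D) y)"
    by (rule Bochner_Integration.integrable_bound[OF F2]) (auto simp: indicator_def)
  have int3: "integrable (measure_pmf q) (indicator (- D) :: _ \<Rightarrow> real)"
    by (rule measure_pmf.integrable_const_bound[where B = 1]) (auto simp: indicator_def)
  have "t \<le> measure_pmf.prob q (- D) - measure_pmf.prob p (- D)"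
    using assms measure_pmf.prob_compl[of D p] measure_pmf.prob_compl[of D q] by (simp add: Compl_eq_Diff_UNIV)
  also have "\<dots> \<le> measure_pmf.expectation q (indicator (- D)) - measure_pmf.expectation q (\<lambda>y. (F y)\<^sup>2 * indicator (- D) y)"
    using expectation_likelihood_ratio_le[of q p "- D"] by (simp add: sq)
  also have "\<dots> = measure_pmf.expectation q (\<lambda>y. indicator (- D) y - (F y)\<^sup>2 * indicator (- D) y)"
    using int2 int3 by simp
  also have "\<dots> \<le> measure_pmf.expectation q (\<lambda>y. t / 2 + 2 / t * (1 - 2 * F y + (F y)\<^sup>2))"
  proof (rule integral_mono)
    show "integrable (measure_pmf q) (\<lambda>y. indicator (- D) y - (F y)\<^sup>2 * indicator (- D) y)"
      using int2 int3 by simp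
    show "integrable (measure_pmf q) (\<lambda>y. t / 2 + 2 / t * (1 - 2 * F y + (F y)\<^sup>2))"
      using F1 F2 by simp
    fix y
    define a where "a = F y"
    have "0 \<le> a" unfolding a_def by (rule F0)
    have pos: "0 \<le> 2 / t * (1 - a)\<^sup>2" using assms by simp
    \<comment> \<open>For \<open>a \<le> 1\<close>, \<open>1 - a^2\<close> is at most
      \<open>2 * (1 - a)\<close>, which the arithmetic-geometric mean inequality with weight
      \<open>t\<close> splits into the two terms. For \<open>a > 1\<close> the left side is
      negative.\<close>
    have "1 - a\<^sup>2 \<le> t / 2 + 2 / t * (1 - a)\<^sup>2"
    proof (cases "a \<le> 1")
      case True
      have "t / 2 + 2 / t * (1 - a)\<^sup>2 - 2 * (1 - a) = (2 * (1 - a) - t)\<^sup>2 / (2 * t)"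
        using assms by (simp add: field_simps power2_eq_square)
      also have "\<dots> \<ge> 0"
        using assms by simp
      finally have "2 * (1 - a) \<le> t / 2 + 2 / t * (1 - a)\<^sup>2"
        by simp
      moreover have "1 - a\<^sup>2 \<le> 2 * (1 - a)"
        using zero_le_power2[of "1 - a"] by (simp add: power2_diff)
      ultimately show ?thesis by linarith
    next
      case False
      then have "1 \<le> a\<^sup>2" by simp
      then show ?thesis using pos assms by linarith
    qed
    then show "indicator (- D) y - (F y)\<^sup>2 * indicator (- D) y \<le> t / 2 + 2 / t * (1 - 2 * F y + (F y)\<^sup>2)"
    proof -
      have "1 - 2 * F y + (F y)\<^sup>2 = (1 - a)\<^sup>2"
        by (simp add: a_def power2_diff)
      then show ?thesis
        using pos assms \<open>1 - a\<^sup>2 \<le> _\<close> by (cases "y \<in> D") (simp_all add: a_def)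
    qed
  qed
  also have "\<dots> = t / 2 + 2 / t * (1 - 2 * measure_pmf.expectation q F + measure_pmf.expectation q (\<lambda>y. (F y)\<^sup>2))"
    using F1 F2 by simp
  \<comment> \<open>The second moment of \<open>F\<close> is replaced by its bound 1 from
    \<open>le1\<close>, leaving the squared Hellinger distance
    \<open>2 - 2 * bhattacharyya p q\<close>.\<close>
  also have "\<dots> \<le> t / 2 + 2 / t * (2 - 2 * measure_pmf.expectation q F)"
    using le1 assms by (intro add_left_mono mult_left_mono) auto
  also have "measure_pmf.expectation q F = bhattacharyya p q"
    by (simp add: bhattacharyya_def F_def[abs_def])
  finally have "t / 2 \<le> 2 / t * (2 - 2 * bhattacharyya p q)"
    by linarith
  then have "t / 2 * (t / 2) \<le> 2 / t * (2 - 2 * bhattacharyya p q) * (t / 2)"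
    using assms(1) by (intro mult_right_mono) auto
  also have "\<dots> = 2 - 2 * bhattacharyya p q"
    using assms(1) by simp
  finally show ?thesis
    by (simp add: power2_eq_square)
qed

text \<open>The geometric mean of two Poisson weights is again an exponential series, with parameter
  \<open>sqrt (x * y)\<close>; completing the square in the exponent gives the formula.\<close>

lemma bhattacharyya_poisson_out:
  assumes "0 \<le> x" "0 \<le> y"
  shows "bhattacharyya (poisson_out x) (poisson_out y) = exp (- (sqrt x - sqrt y)\<^sup>2 / 2)"
proof -
  let ?f = "\<lambda>k. sqrt (pmf (poisson_out x) k / pmf (poisson_out y) k)"
  have w: "y ^ k / fact k * exp (- y) * ?f k = sqrt (x * y) ^ k / fact k * exp (- (x + y) / 2)" for k
  proof -
    let ?p = "pmf (poisson_out x) k" and ?q = "pmf (poisson_out y) k"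
    have half: "sqrt (exp (- z)) = exp (- z / 2)" for z :: real
      using exp_double[of "- z / 2"] by (intro real_sqrt_unique) simp_all
    have "?q * ?f k = sqrt (?p * ?q)"
    proof (cases "?q = 0")
      case False
      have "?p * ?q = ?q\<^sup>2 * (?p / ?q)"
        using False by (simp add: power2_eq_square)
      then show ?thesis
        by (simp only: real_sqrt_mult) simp
    qed simp
    also have "?p * ?q = (x * y) ^ k / (fact k)\<^sup>2 * exp (- (x + y))"
    proof -
      have "exp (- (x + y)) = exp (- x) * exp (- y)"
        by (simp add: mult_exp_exp)
      then show ?thesis
        using assms by (simp only: pmf_poisson_out power_mult_distrib power2_eq_square) simp
    qed
    also have "sqrt \<dots> = sqrt (x * y) ^ k / fact k * exp (- (x + y) / 2)"
      by (simp only: real_sqrt_mult real_sqrt_divide real_sqrt_power half) simp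
    finally show ?thesis
      using assms by (simp add: pmf_poisson_out)
  qed
  have "(\<lambda>k. sqrt (x * y) ^ k / fact k * exp (- (x + y) / 2)) sums (exp (sqrt (x * y)) * exp (- (x + y) / 2))"
    by (intro sums_mult2 exp_sums)
  also have "exp (sqrt (x * y)) * exp (- (x + y) / 2) = exp (- (sqrt x - sqrt y)\<^sup>2 / 2)"
  proof -
    have "sqrt (x * y) + - (x + y) / 2 = - (sqrt x - sqrt y)\<^sup>2 / 2"
      using assms by (simp add: power2_diff real_sqrt_mult field_simps)
    then show ?thesis by (simp only: mult_exp_exp)
  qed
  finally have s: "(\<lambda>k. y ^ k / fact k * exp (- y) * ?f k) sums exp (- (sqrt x - sqrt y)\<^sup>2 / 2)"
    unfolding w .
  have abs: "\<bar>?f k\<bar> = ?f k" for k by simp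
  have "summable (\<lambda>k. y ^ k / fact k * exp (- y) * \<bar>?f k\<bar>)"
    using s unfolding abs by (simp add: sums_iff)
  from poisson_out_integral(2)[OF assms(2) this s] show ?thesis
    unfolding bhattacharyya_def .
qed

lemma real_sqrt_prod: "sqrt (\<Prod>i\<in>A. f i) = (\<Prod>i\<in>A. sqrt (f i))"
  by (induction A rule: infinite_finite_induct) (simp_all add: real_sqrt_mult)

lemma bhattacharyya_Pi_pmf:
  assumes "finite A"
  shows "bhattacharyya (Pi_pmf A d p) (Pi_pmf A d q) = (\<Prod>i\<in>A. bhattacharyya (p i) (q i))"
proof -
  have "bhattacharyya (Pi_pmf A d p) (Pi_pmf A d q) =
      measure_pmf.expectation (Pi_pmf A d q) (\<lambda>y. \<Prod>i\<in>A. sqrt (pmf (p i) (y i) / pmf (q i) (y i)))"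
    unfolding bhattacharyya_def
  \<comment> \<open>The product formula for the mass function needs \<open>y\<close> to equal
    \<open>d\<close> outside \<open>A\<close>. This holds on the support of the second measure, so
    the integrands are compared only there.\<close>
  proof (intro integral_cong_AE AE_pmfI)
    fix y assume "y \<in> set_pmf (Pi_pmf A d q)"
    then have "\<forall>x. x \<notin> A \<longrightarrow> y x = d"
      using subsetD[OF set_Pi_pmf_subset[OF assms]] by simp
    then have "pmf (Pi_pmf A d r) y = (\<Prod>i\<in>A. pmf (r i) (y i))" for r
      using assms by (intro pmf_Pi') auto
    then show "sqrt (pmf (Pi_pmf A d p) y / pmf (Pi_pmf A d q) y) =
        (\<Prod>i\<in>A. sqrt (pmf (p i) (y i) / pmf (q i) (y i)))"
      by (simp only: real_sqrt_prod[symmetric] prod_dividef)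
  qed simp_all
  also have "\<dots> = (\<Prod>i\<in>A. bhattacharyya (p i) (q i))"
    unfolding bhattacharyya_def
    by (rule expectation_prod_Pi_pmf[where f = "\<lambda>i v. sqrt (pmf (p i) v / pmf (q i) v)"])
       (simp_all add: assms integrable_sqrt_likelihood_ratio)
  finally show ?thesis .
qed

lemma bhattacharyya_poisson_prod:
  assumes "\<And>i. i < n \<Longrightarrow> 0 \<le> x i" "\<And>i. i < n \<Longrightarrow> 0 \<le> y i"
  shows "bhattacharyya (poisson_prod n x) (poisson_prod n y) = exp (- (\<Sum>i<n. (sqrt (x i) - sqrt (y i))\<^sup>2) / 2)"
proof -
  have "bhattacharyya (poisson_prod n x) (poisson_prod n y) = (\<Prod>i<n. exp (- (sqrt (x i) - sqrt (y i))\<^sup>2 / 2))"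
    unfolding poisson_prod_def using assms by (simp add: bhattacharyya_Pi_pmf bhattacharyya_poisson_out)
  also have "\<dots> = exp (\<Sum>i<n. - (sqrt (x i) - sqrt (y i))\<^sup>2 / 2)"
    by (simp add: exp_sum)
  also have "(\<Sum>i<n. - (sqrt (x i) - sqrt (y i))\<^sup>2 / 2) = - (\<Sum>i<n. (sqrt (x i) - sqrt (y i))\<^sup>2) / 2"
    by (simp only: sum_negf flip: sum_divide_distrib)
  finally show ?thesis .
qed

text \<open>Turns a statistical gap into a Euclidean one independent of \<open>n\<close>:
  \<open>2 - 2 * exp (- S / 2) \<le> S\<close> for the squared distance \<open>S\<close>.\<close>

lemma sqrt_separation_of_prob_diff:
  assumes "\<And>i. i < n \<Longrightarrow> 0 \<le> x i" "\<And>i. i < n \<Longrightarrow> 0 \<le> y i"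
    and "0 < t" "t \<le> measure_pmf.prob (poisson_prod n x) D - measure_pmf.prob (poisson_prod n y) D"
  shows "t\<^sup>2 / 4 \<le> (\<Sum>i<n. (sqrt (x i) - sqrt (y i))\<^sup>2)"
proof -
  let ?S = "\<Sum>i<n. (sqrt (x i) - sqrt (y i))\<^sup>2"
  have "t\<^sup>2 / 4 \<le> 2 - 2 * exp (- ?S / 2)"
    using bhattacharyya_le_of_prob_diff[OF assms(3,4)] bhattacharyya_poisson_prod[of n x y] assms(1,2) by simp
  also have "\<dots> \<le> ?S"
    using exp_ge_add_one_self[of "- ?S / 2"] by linarith
  finally show ?thesis .
qed

section \<open>The upper bound\<close>

text \<open>Weighting each \<open>z\<close> by \<open>q ^ (\<Sum> z)\<close> turns the count into a product of geometric series.\<close>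

lemma card_bounded_sum_le:
  fixes Z :: "('i \<Rightarrow> nat) set" and q :: real
  assumes "finite I" "0 < q" "q < 1" "Z \<subseteq> I \<rightarrow>\<^sub>E UNIV" "\<And>z. z \<in> Z \<Longrightarrow> sum z I \<le> M"
  shows "finite Z" "card Z * q ^ M \<le> (1 / (1 - q)) ^ card I"
proof -
  have sub: "Z \<subseteq> I \<rightarrow>\<^sub>E {..M}"
  proof
    fix z assume z: "z \<in> Z"
    have "z i \<le> M" if "i \<in> I" for i
      using assms(5)[OF z] member_le_sum[of i I z] that assms(1) by fastforce
    then show "z \<in> I \<rightarrow>\<^sub>E {..M}"
      using z assms(4) by (auto simp: PiE_iff)
  qed
  have fin: "finite (I \<rightarrow>\<^sub>E {..M})"
    using assms(1) by (intro finite_PiE) auto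
  show "finite Z" by (rule finite_subset[OF sub fin])
  have "card Z * q ^ M = (\<Sum>z\<in>Z. q ^ M)" by simp
  also have "\<dots> \<le> (\<Sum>z\<in>Z. \<Prod>i\<in>I. q ^ z i)"
    using assms by (intro sum_mono) (auto simp: power_sum[symmetric] intro!: power_decreasing)
  also have "\<dots> \<le> (\<Sum>z\<in>I \<rightarrow>\<^sub>E {..M}. \<Prod>i\<in>I. q ^ z i)"
    using assms by (intro sum_mono2 fin sub prod_nonneg) auto
  also have "\<dots> = (\<Prod>i\<in>I. \<Sum>k\<le>M. q ^ k)"
    using assms(1) by (subst prod_sum_PiE) auto
  also have "\<dots> \<le> (\<Prod>i\<in>I. 1 / (1 - q))"
  proof (intro prod_mono conjI)
    show "(\<Sum>k\<le>M. q ^ k) \<le> 1 / (1 - q)"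
      using assms by (auto simp: sum_gp0 intro!: divide_right_mono)
    show "0 \<le> (\<Sum>k\<le>M. q ^ k)"
      using assms by (intro sum_nonneg) auto
  qed
  also have "\<dots> = (1 / (1 - q)) ^ card I" by simp
  finally show "card Z * q ^ M \<le> (1 / (1 - q)) ^ card I" .
qed

lemma DI_code_size_le:
  assumes "0 < E" "l1 + l2 < 1" "0 < n" and code: "is_DI_code E n N l1 l2 u D"
  shows "real N \<le> (exp (2 * (1 + E) / (1 - l1 - l2)) * (1 + sqrt n)) ^ n"
proof -
  define t where "t = 1 - l1 - l2"
  \<comment> \<open>Mesh of the grid: two inputs in one cell would have squared root-distance at
    most \<open>n * s^2 = t^2 / 16\<close>, below the forced separation
    \<open>t^2 / 4\<close>.\<close>
  define s where "s = t / (4 * sqrt n)"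
  define C where "C = 2 * (1 + E) / t"
  \<comment> \<open>Since \<open>sqrt u \<le> (1 + u) / 2\<close>, the power constraint bounds the
    sum of cell indices by \<open>n * (1 + E) / (2 * s)\<close>, which equals
    \<open>n * sqrt n * C\<close>.\<close>
  define M where "M = nat \<lfloor>n * sqrt n * C\<rfloor>"
  \<comment> \<open>This weight balances the count: \<open>q ^ M\<close> is at least
    \<open>exp (- n * C)\<close>, a loss exponential in \<open>n\<close> only, while each geometric
    series stays below \<open>1 + sqrt n\<close>.\<close>
  define q where "q = exp (- 1 / sqrt n)"
  \<comment> \<open>Restricting to \<open>{..<n}\<close> discards the arbitrary values of
    \<open>u j\<close> beyond the block.\<close>
  define z where "z j = (\<lambda>i\<in>{..<n}. nat \<lfloor>sqrt (u j i) / s\<rfloor>)" for j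
  have "0 < t" using assms by (simp add: t_def)
  have "0 < s" "0 < C" using \<open>0 < t\<close> assms by (simp_all add: s_def C_def)
  have u0: "0 \<le> u j i" and usum: "(\<Sum>i<n. u j i) \<le> n * E"
    and good: "1 - l1 \<le> measure_pmf.prob (poisson_prod n (u j)) (D j)" if "j < N" "i < n" for i j
    using code that by (auto simp: is_DI_code_def)
  have sep: "t\<^sup>2 / 4 \<le> (\<Sum>i<n. (sqrt (u j i) - sqrt (u k i))\<^sup>2)" if "j < N" "k < N" "j \<noteq> k" for j k
  proof (rule sqrt_separation_of_prob_diff)
    have "measure_pmf.prob (poisson_prod n (u k)) (D j) \<le> l2"
      using code that by (auto simp: is_DI_code_def)
    then show "t \<le> measure_pmf.prob (poisson_prod n (u j)) (D j) - measure_pmf.prob (poisson_prod n (u k)) (D j)"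
      using good[OF that(1) assms(3)] by (simp add: t_def)
  qed (use u0 that \<open>0 < t\<close> in auto)
  have inj: "inj_on z {..<N}"
  proof (rule inj_onI, rule ccontr)
    fix j k assume jk: "j \<in> {..<N}" "k \<in> {..<N}" "z j = z k" "j \<noteq> k"
    have "(sqrt (u j i) - sqrt (u k i))\<^sup>2 \<le> s\<^sup>2" if "i < n" for i
    proof -
      have "nat \<lfloor>sqrt (u j i) / s\<rfloor> = nat \<lfloor>sqrt (u k i) / s\<rfloor>"
        using fun_cong[OF jk(3), of i] that by (simp add: z_def)
      then have "\<lfloor>sqrt (u j i) / s\<rfloor> = \<lfloor>sqrt (u k i) / s\<rfloor>"
        using u0 jk that \<open>0 < s\<close> by (simp add: eq_nat_nat_iff)
      then have "\<bar>sqrt (u j i) / s - sqrt (u k i) / s\<bar> \<le> 1" by linarith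
      then have "\<bar>sqrt (u j i) - sqrt (u k i)\<bar> \<le> s"
        using \<open>0 < s\<close> by (simp flip: diff_divide_distrib)
      then show ?thesis
        using \<open>0 < s\<close> by (intro abs_le_square_iff[THEN iffD1]) simp
    qed
    then have "(\<Sum>i<n. (sqrt (u j i) - sqrt (u k i))\<^sup>2) \<le> (\<Sum>i<n. s\<^sup>2)"
      by (intro sum_mono) auto
    also have "\<dots> = t\<^sup>2 / 16"
      using assms by (simp add: s_def power_divide power_mult_distrib)
    finally show False
      using sep[of j k] jk zero_less_power[OF \<open>0 < t\<close>, of 2] by simp
  qed
  have zsum: "(\<Sum>i<n. z j i) \<le> M" if j: "j < N" for j
  proof -
    have "real (\<Sum>i<n. z j i) \<le> (\<Sum>i<n. (1 + u j i) / (2 * s))"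
      unfolding of_nat_sum
    proof (rule sum_mono)
      fix i assume i: "i \<in> {..<n}"
      have "real (z j i) \<le> sqrt (u j i) / s"
        using i u0[OF j, of i] \<open>0 < s\<close> by (simp add: z_def)
      also have "sqrt (u j i) \<le> (1 + u j i) / 2"
        using arith_geo_mean_sqrt[of 1 "u j i"] u0[OF j, of i] i by simp
      finally show "real (z j i) \<le> (1 + u j i) / (2 * s)"
        using \<open>0 < s\<close> by (simp add: field_simps)
    qed
    also have "\<dots> = (n + (\<Sum>i<n. u j i)) / (2 * s)"
      by (simp add: sum.distrib flip: sum_divide_distrib)
    also have "\<dots> \<le> (n + n * E) / (2 * s)"
      using usum[OF j assms(3)] \<open>0 < s\<close> by (intro divide_right_mono) auto
    also have "\<dots> = n * sqrt n * C"
      using \<open>0 < t\<close> by (simp add: s_def C_def field_simps)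
    finally show ?thesis unfolding M_def by (simp add: le_nat_floor)
  qed
  have q: "0 < q" "q < 1" using assms by (simp_all add: q_def)
  have "real N * q ^ M \<le> (1 / (1 - q)) ^ n"
  proof -
    have sub: "z ` {..<N} \<subseteq> {..<n} \<rightarrow>\<^sub>E UNIV"
      by (simp add: image_subset_iff z_def PiE_iff)
    have "sum y {..<n} \<le> M" if "y \<in> z ` {..<N}" for y
      using that zsum by blast
    from card_bounded_sum_le(2)[OF finite_lessThan[of n] q sub this] show ?thesis
      using inj by (simp add: card_image)
  qed
  also have "\<dots> \<le> (1 + sqrt n) ^ n"
  proof (rule power_mono)
    have "q * (1 + 1 / sqrt n) \<le> q * exp (1 / sqrt n)"
      using q by (intro mult_left_mono exp_ge_add_one_self) auto
    also have "\<dots> = 1" by (simp add: q_def mult_exp_exp)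
    finally have "q * (1 + sqrt n) \<le> sqrt n"
      using assms by (simp add: field_simps)
    then have "1 \<le> (1 + sqrt n) * (1 - q)"
      by (simp add: algebra_simps)
    then show "1 / (1 - q) \<le> 1 + sqrt n"
      using q by (simp add: pos_divide_le_eq)
  qed (use q in simp)
  finally have 1: "real N * q ^ M \<le> (1 + sqrt n) ^ n" .
  have "real M \<le> n * sqrt n * C"
    using \<open>0 < C\<close> by (simp add: M_def)
  then have "M / sqrt n \<le> n * C"
    using assms by (simp add: field_simps)
  then have "exp (- (n * C)) \<le> q ^ M"
    by (simp add: q_def flip: exp_of_nat_mult)
  then have "real N * exp (- (n * C)) \<le> (1 + sqrt n) ^ n"
    using 1 by (meson mult_left_mono of_nat_0_le_iff order_trans)
  then have "real N \<le> exp (n * C) * (1 + sqrt n) ^ n"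
    by (simp add: exp_minus field_simps)
  also have "\<dots> = (exp C * (1 + sqrt n)) ^ n"
    by (simp add: power_mult_distrib exp_of_nat_mult)
  finally show ?thesis by (simp add: C_def t_def)
qed

section \<open>Extended-real logarithms and the limit superior of the rate\<close>

lemma elog2_ge:
  assumes "0 < B" "ereal B \<le> z"
  shows "ereal (log 2 B) \<le> elog2 z"
  using assms by (cases z) (auto simp: elog2_def)

text \<open>The condition \<open>1 \<le> B\<close> covers \<open>z = 0\<close>, where the logarithm
  takes the default value 0.\<close>

lemma elog2_le:
  assumes "1 \<le> B" "0 \<le> z" "z \<le> ereal B"
  shows "elog2 z \<le> ereal (log 2 B)"
proof (cases z)
  case (real r)
  then show ?thesis
    using assms by (cases "r = 0") (auto simp: elog2_def log_def intro!: divide_right_mono)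
qed (use assms in auto)

lemma N_DI_nonneg: "0 \<le> N_DI E n l1 l2"
proof -
  have "is_DI_code E n 0 l1 l2 u D" for u D
    by (simp add: is_DI_code_def)
  then have "ereal (real 0) \<le> N_DI E n l1 l2"
    unfolding N_DI_def by (intro Sup_upper) blast
  then show ?thesis by (simp add: zero_ereal_def)
qed

lemma limsup_DI_rate_le:
  assumes "0 < E" "l1 + l2 < 1"
  shows "limsup (DI_rate E l1 l2) \<le> ereal (1/2)"
proof -
  define C where "C = 2 * (1 + E) / (1 - l1 - l2)"
  have "0 \<le> C" using assms by (simp add: C_def)
  define g where "g n = log 2 (exp C * (1 + sqrt (real n))) / log 2 (real n)" for n :: nat
  have le: "DI_rate E l1 l2 n \<le> ereal (g n)" if "2 \<le> n" for n
  proof -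
    let ?B = "exp C * (1 + sqrt n)"
    have "1 * 1 \<le> ?B"
      using \<open>0 \<le> C\<close> by (intro mult_mono) auto
    then have B: "1 \<le> ?B" by simp
    have "N_DI E n l1 l2 \<le> ereal (?B ^ n)"
      unfolding N_DI_def C_def
      by (rule Sup_least) (use DI_code_size_le[OF assms, of n] that in auto)
    then have "elog2 (N_DI E n l1 l2) \<le> ereal (log 2 (?B ^ n))"
      using B by (intro elog2_le N_DI_nonneg) auto
    also have "log 2 (?B ^ n) = n * log 2 ?B"
      using B by (subst log_nat_power) auto
    finally have "DI_rate E l1 l2 n \<le> ereal (n * log 2 ?B) * ereal (1 / (real n * log 2 (real n)))"
      unfolding DI_rate_def using that by (intro ereal_mult_right_mono) auto
    also have "\<dots> = ereal (g n)"
      using that by (simp add: g_def)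
    finally show ?thesis .
  qed
  have "g \<longlonglongrightarrow> 1/2"
    unfolding g_def by real_asymp
  then have "(\<lambda>n. ereal (g n)) \<longlonglongrightarrow> ereal (1/2)" by simp
  then have "limsup (\<lambda>n. ereal (g n)) = ereal (1/2)"
    by (intro lim_imp_Limsup) auto
  moreover have "limsup (DI_rate E l1 l2) \<le> limsup (\<lambda>n. ereal (g n))"
    by (rule Limsup_mono) (use le in \<open>auto simp: eventually_at_top_linorder\<close>)
  ultimately show ?thesis by simp
qed

section \<open>Gilbert-Varshamov codes\<close>

text \<open>Around a maximal separated set the balls of non-separated points cover \<open>X\<close>,
  since any uncovered point could be added.\<close>

lemma Gilbert_Varshamov_general:
  assumes "finite X" "\<And>x. x \<in> X \<Longrightarrow> card {y \<in> X. \<not> sep x y} \<le> b"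
    and refl: "\<And>x. x \<in> X \<Longrightarrow> \<not> sep x x" and sym: "\<And>x y. sep x y \<Longrightarrow> sep y x"
  shows "\<exists>C\<subseteq>X. (\<forall>x\<in>C. \<forall>y\<in>C. x \<noteq> y \<longrightarrow> sep x y) \<and> card X \<le> card C * b"
proof -
  define P where "P = {C. C \<subseteq> X \<and> (\<forall>x\<in>C. \<forall>y\<in>C. x \<noteq> y \<longrightarrow> sep x y)}"
  have "finite P" "{} \<in> P"
    using assms(1) by (auto simp: P_def)
  then obtain C where C: "C \<in> P" and max: "\<And>D. D \<in> P \<Longrightarrow> C \<subseteq> D \<Longrightarrow> D = C"
    using finite_has_maximal[of P] by (metis empty_iff)
  have CX: "C \<subseteq> X" using C by (simp add: P_def)
  have "X \<subseteq> (\<Union>c\<in>C. {y \<in> X. \<not> sep c y})"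
  proof
    fix x assume x: "x \<in> X"
    have "\<exists>c\<in>C. \<not> sep c x"
    proof (rule ccontr)
      assume far: "\<not> (\<exists>c\<in>C. \<not> sep c x)"
      then have "sep c x \<and> sep x c" if "c \<in> C" for c
        using that sym by simp
      then have "insert x C \<in> P"
        using C x unfolding P_def by simp
      then have "x \<in> C" using max[of "insert x C"] by auto
      then show False using far refl x by auto
    qed
    then show "x \<in> (\<Union>c\<in>C. {y \<in> X. \<not> sep c y})" using x by auto
  qed
  then have "card X \<le> card (\<Union>c\<in>C. {y \<in> X. \<not> sep c y})"
    using assms(1) CX by (intro card_mono finite_UN_I) (auto intro: finite_subset)
  also have "\<dots> \<le> (\<Sum>c\<in>C. card {y \<in> X. \<not> sep c y})"
    using assms(1) CX by (intro card_UN_le) (auto intro: finite_subset)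
  also have "\<dots> \<le> card C * b"
    using CX assms(2) by (intro sum_bounded_above[of C _ b, simplified]) auto
  finally show ?thesis
    using C by (auto simp: P_def)
qed

text \<open>A word of the ball is fixed by the set of positions where it leaves \<open>w\<close> and
  its letters there. Counting all subsets costs \<open>2 ^ card I\<close>, negligible on the scale
  \<open>n log n\<close>.\<close>

lemma Hamming_ball_card_le:
  fixes I :: "'i set" and Q :: "'b set"
  assumes "finite I" "finite Q" "w \<in> I \<rightarrow>\<^sub>E Q" "Q \<noteq> {}" "0 \<le> r"
  shows "real (card {v \<in> I \<rightarrow>\<^sub>E Q. real (card {i \<in> I. w i \<noteq> v i}) < r}) \<le> 2 ^ card I * card Q powr r"
proof -
  let ?B = "{v \<in> I \<rightarrow>\<^sub>E Q. real (card {i \<in> I. w i \<noteq> v i}) < r}"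
  \<comment> \<open>The words that agree with \<open>w\<close> off \<open>S\<close>.\<close>
  define F where "F S = PiE I (\<lambda>i. if i \<in> S then Q else {w i})" for S
  define T where "T = {S \<in> Pow I. real (card S) < r}"
  have q1: "1 \<le> card Q"
    using assms by (simp add: Suc_leI card_gt_0_iff)
  have "finite T" using assms(1) by (simp add: T_def)
  have fin: "finite (F S)" for S
    using assms unfolding F_def by (intro finite_PiE) auto
  have "?B \<subseteq> (\<Union>S\<in>T. F S)"
  proof
    fix v assume v: "v \<in> ?B"
    then have "{i \<in> I. w i \<noteq> v i} \<in> T" by (simp add: T_def)
    moreover have "v \<in> F {i \<in> I. w i \<noteq> v i}"
      using v by (auto simp: F_def PiE_iff)
    ultimately show "v \<in> (\<Union>S\<in>T. F S)" by blast
  qed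
  then have "card ?B \<le> card (\<Union>S\<in>T. F S)"
    using \<open>finite T\<close> fin by (intro card_mono) auto
  also have "\<dots> \<le> (\<Sum>S\<in>T. card (F S))"
    using \<open>finite T\<close> by (rule card_UN_le)
  finally have "real (card ?B) \<le> (\<Sum>S\<in>T. real (card (F S)))"
    by (simp flip: of_nat_sum)
  also have "\<dots> \<le> (\<Sum>S\<in>T. card Q powr r)"
  proof (rule sum_mono)
    fix S assume S: "S \<in> T"
    have "card (F S) = (\<Prod>i\<in>I. if i \<in> S then card Q else 1)"
      unfolding F_def card_PiE[OF assms(1)] by (intro prod.cong) auto
    also have "\<dots> = card Q ^ card (I \<inter> S)"
      using assms(1) by (simp add: prod.If_cases)
    also have "I \<inter> S = S" using S by (auto simp: T_def)
    finally have "real (card (F S)) = card Q powr real (card S)"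
      using q1 by (simp add: powr_realpow)
    also have "\<dots> \<le> card Q powr r"
      using S q1 by (intro powr_mono) (auto simp: T_def)
    finally show "real (card (F S)) \<le> card Q powr r" .
  qed
  also have "\<dots> = card T * card Q powr r" by simp
  also have "\<dots> \<le> 2 ^ card I * card Q powr r"
  proof (rule mult_right_mono)
    have "card T \<le> card (Pow I)"
      using assms(1) by (intro card_mono) (auto simp: T_def)
    then have "real (card T) \<le> real (2 ^ card I)"
      unfolding card_Pow[OF assms(1)] by (rule of_nat_mono)
    then show "real (card T) \<le> 2 ^ card I" by simp
  qed simp
  finally show ?thesis .
qed

lemma Hamming_code_exists:
  fixes I :: "'i set" and Q :: "'b set"
  assumes "finite I" "finite Q" "Q \<noteq> {}" "0 < r"
  shows "\<exists>C \<subseteq> I \<rightarrow>\<^sub>E Q.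
    (\<forall>v\<in>C. \<forall>w\<in>C. v \<noteq> w \<longrightarrow> r \<le> real (card {i \<in> I. v i \<noteq> w i})) \<and>
    real (card Q) ^ card I \<le> card C * (2 ^ card I * card Q powr r)"
proof -
  let ?X = "I \<rightarrow>\<^sub>E Q"
  let ?sep = "\<lambda>v w. r \<le> real (card {i \<in> I. v i \<noteq> w i})"
  let ?b = "2 ^ card I * card Q powr r"
  have fin: "finite ?X" using assms by (intro finite_PiE) auto
  have "\<exists>C\<subseteq>?X. (\<forall>v\<in>C. \<forall>w\<in>C. v \<noteq> w \<longrightarrow> ?sep v w) \<and> card ?X \<le> card C * nat \<lfloor>?b\<rfloor>"
  proof (rule Gilbert_Varshamov_general[OF fin, of ?sep "nat \<lfloor>?b\<rfloor>"])
    show "card {y \<in> ?X. \<not> ?sep x y} \<le> nat \<lfloor>?b\<rfloor>" if "x \<in> ?X" for x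
      using Hamming_ball_card_le[OF assms(1,2) that assms(3), of r] assms(4)
      by (intro le_nat_floor) (simp add: not_le)
    show "\<not> ?sep x x" for x using assms(4) by simp
    show "?sep y x" if "?sep x y" for x y
      using that by (simp add: eq_commute)
  qed
  then obtain C where C: "C \<subseteq> ?X" "\<forall>v\<in>C. \<forall>w\<in>C. v \<noteq> w \<longrightarrow> ?sep v w"
    "card ?X \<le> card C * nat \<lfloor>?b\<rfloor>"
    by (elim exE conjE)
  have "real (card Q) ^ card I = real (card ?X)"
    using assms(1) by (simp add: card_PiE)
  also have "\<dots> \<le> card C * real (nat \<lfloor>?b\<rfloor>)"
    using of_nat_mono[OF C(3)] by (simp only: of_nat_mult)
  also have "\<dots> \<le> card C * ?b"
    by (intro mult_left_mono) auto
  finally show ?thesis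
    using C(1,2) by (intro exI[of _ C] conjI)
qed

section \<open>The lower bound\<close>

text \<open>One Chebyshev estimate serves both error types: \<open>a\<close> is the tested codeword
  and \<open>x\<close> the transmitted one, equal or not.\<close>

lemma poisson_prod_test_deviation:
  assumes "\<And>i. i < n \<Longrightarrow> 0 \<le> x i \<and> x i \<le> E" "\<And>i. i < n \<Longrightarrow> 0 \<le> a i \<and> a i \<le> E" "0 < t"
  shows "measure_pmf.prob (poisson_prod n x)
      {y. t \<le> \<bar>(\<Sum>i<n. (real (y i) - a i)\<^sup>2 - real (y i)) - (\<Sum>i<n. (x i - a i)\<^sup>2)\<bar>}
    \<le> n * ((3 + 2 * E\<^sup>2)\<^sup>2 * exp (E * (exp 2 - 1))) / t\<^sup>2"
proof -
  let ?V = "(3 + 2 * E\<^sup>2)\<^sup>2 * exp (E * (exp 2 - 1))"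
  define g where "g i k = (real k - a i)\<^sup>2 - real k - (x i - a i)\<^sup>2" for i k
  have g1: "integrable (measure_pmf (poisson_out (x i))) (g i)"
    and g0: "measure_pmf.expectation (poisson_out (x i)) (g i) = 0" if "i \<in> {..<n}" for i
    unfolding g_def using poisson_out_squared_distance[of "x i" "a i"] assms(1)[of i] that by auto
  have g2: "integrable (measure_pmf (poisson_out (x i))) (\<lambda>k. (g i k)\<^sup>2)"
    and gV: "measure_pmf.expectation (poisson_out (x i)) (\<lambda>k. (g i k)\<^sup>2) \<le> ?V" if "i \<in> {..<n}" for i
    unfolding g_def using poisson_out_squared_distance_variance[of "x i" E "a i"] assms(1,2)[of i] that by auto
  have S: "integrable (measure_pmf (poisson_prod n x)) (\<lambda>y. (\<Sum>i<n. g i (y i))\<^sup>2)"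
    "measure_pmf.expectation (poisson_prod n x) (\<lambda>y. (\<Sum>i<n. g i (y i))\<^sup>2) =
      (\<Sum>i<n. measure_pmf.expectation (poisson_out (x i)) (\<lambda>k. (g i k)\<^sup>2))"
    unfolding poisson_prod_def
    by (intro expectation_sum_square_Pi_pmf finite_lessThan g1 g2 g0; assumption)+
  have "(\<Sum>i<n. measure_pmf.expectation (poisson_out (x i)) (\<lambda>k. (g i k)\<^sup>2)) \<le> of_nat (card {..<n}) * ?V"
    by (intro sum_bounded_above gV)
  then have "measure_pmf.expectation (poisson_prod n x) (\<lambda>y. (\<Sum>i<n. g i (y i))\<^sup>2) \<le> n * ?V"
    unfolding S(2) by simp
  then have "measure_pmf.prob (poisson_prod n x) {y. t \<le> \<bar>\<Sum>i<n. g i (y i)\<bar>} \<le> n * ?V / t\<^sup>2"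
    using S(1) assms(3) by (intro measure_pmf_Chebyshev)
  then show ?thesis
    by (simp add: g_def sum_subtractf)
qed

text \<open>Codewords are Hamming-separated words over \<open>{1..q}\<close> scaled by the mesh. The
  bound on \<open>q\<close> keeps every coordinate at most \<open>E\<close>, which implies the
  average power constraint.\<close>

lemma DI_code_exists:
  fixes E l \<epsilon> :: real
  defines "V \<equiv> (3 + 2 * E\<^sup>2)\<^sup>2 * exp (E * (exp 2 - 1))"
  defines "K \<equiv> sqrt (V / l)"
  assumes "0 < E" "0 < l" "l \<le> l1" "l \<le> l2" "0 < \<epsilon>" "0 < n"
    and q: "0 < q" "real q * sqrt (2 * K / (\<epsilon> * sqrt n)) \<le> E"
  shows "\<exists>N u D. is_DI_code E n N l1 l2 u D \<and> real q ^ n \<le> N * (2 ^ n * q powr (\<epsilon> * n))"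
proof -
  \<comment> \<open>The mesh is chosen so that \<open>\<epsilon> * n\<close> differing positions
    give squared distance at least \<open>2 * t\<close>.\<close>
  define s where "s = sqrt (2 * K / (\<epsilon> * sqrt n))"
  \<comment> \<open>With this threshold the Chebyshev bound \<open>n * V / t^2\<close> equals
    \<open>l\<close>. It lies midway between the mean 0 for the true codeword and
    \<open>2 * t\<close>, the least mean for another.\<close>
  define t where "t = K * sqrt n"
  have "0 < V" using assms(3) unfolding V_def
    by (intro mult_pos_pos zero_less_power add_pos_nonneg) auto
  then have "0 < K" using assms(4) unfolding K_def by simp
  have "0 < s" "0 < t" and s2: "s\<^sup>2 * (\<epsilon> * n) = 2 * t"
    using \<open>0 < K\<close> assms(7,8) unfolding s_def t_def by (simp_all add: field_simps power2_eq_square)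
  have Vt: "n * V / t\<^sup>2 = l"
    using \<open>0 < V\<close> assms(4,8) by (simp add: t_def K_def power_mult_distrib)
  have "finite {1..q}" "{1..q} \<noteq> {}" "0 < \<epsilon> * n" using assms(7,8) q by simp_all
  from Hamming_code_exists[OF finite_lessThan[of n] this]
  obtain C where C: "C \<subseteq> {..<n} \<rightarrow>\<^sub>E {1..q}"
      and Csep: "\<forall>v\<in>C. \<forall>w\<in>C. v \<noteq> w \<longrightarrow> \<epsilon> * n \<le> real (card {i \<in> {..<n}. v i \<noteq> w i})"
      and Ccard: "real (card {1..q}) ^ card {..<n} \<le> card C * (2 ^ card {..<n} * card {1..q} powr (\<epsilon> * n))"
    by (elim exE conjE)
  have "finite C"
    by (rule finite_subset[OF C finite_PiE]) auto
  obtain c where c: "bij_betw c {..<card C} C"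
    using ex_bij_betw_nat_finite[OF \<open>finite C\<close>] by (auto simp: atLeast0LessThan)
  define u where "u j i = s * real (c j i)" for j i
  define D where "D j = {y. (\<Sum>i<n. (real (y i) - u j i)\<^sup>2 - real (y i)) < t}" for j
  have cC: "c j \<in> C" if "j < card C" for j
    using c that by (auto simp: bij_betw_def)
  have u: "0 \<le> u j i \<and> u j i \<le> E" if "j < card C" "i < n" for i j
  proof -
    have "c j i \<in> {1..q}" using cC[OF that(1)] C that(2) by (auto simp: PiE_iff)
    then have "s * real (c j i) \<le> s * q" using \<open>0 < s\<close> by simp
    also have "s * q \<le> E" using q(2) by (simp only: s_def mult.commute)
    finally show ?thesis
      using \<open>0 < s\<close> by (simp add: u_def)
  qed
  note dev = poisson_prod_test_deviation[of n _ E _ t, folded V_def, unfolded Vt]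
  have "is_DI_code E n (card C) l1 l2 u D"
    unfolding is_DI_code_def
  proof (intro conjI allI impI)
    fix j assume j: "j < card C"
    show "0 \<le> u j i" if "i < n" for i using u[OF j that] by simp
    have "(\<Sum>i<n. u j i) \<le> of_nat (card {..<n}) * E"
      using u[OF j] by (intro sum_bounded_above) auto
    then show "(\<Sum>i<n. u j i) \<le> n * E" by simp
    let ?p = "poisson_prod n (u j)"
    \<comment> \<open>For the true codeword the squared distance is 0, so a miss is a deviation of
      at least \<open>t\<close>.\<close>
    have "measure_pmf.prob ?p (- D j) \<le> measure_pmf.prob ?p
        {y. t \<le> \<bar>(\<Sum>i<n. (real (y i) - u j i)\<^sup>2 - real (y i)) - (\<Sum>i<n. (u j i - u j i)\<^sup>2)\<bar>}"
      by (rule measure_pmf.finite_measure_mono) (auto simp: D_def)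
    also have "\<dots> \<le> l"
      using u[OF j] \<open>0 < t\<close> by (intro dev) auto
    finally show "1 - l1 \<le> measure_pmf.prob ?p (D j)"
      using measure_pmf.prob_compl[of "D j" ?p] assms(5) by (simp add: Compl_eq_Diff_UNIV)
  next
    fix j k assume jk: "j < card C" "k < card C" "j \<noteq> k"
    let ?p = "poisson_prod n (u j)"
    have "c j \<noteq> c k"
      using c jk by (auto simp: bij_betw_def inj_on_def)
    then have "\<epsilon> * n \<le> real (card {i \<in> {..<n}. c j i \<noteq> c k i})"
      using Csep cC[OF jk(1)] cC[OF jk(2)] by simp
    then have "2 * t \<le> s\<^sup>2 * real (card {i \<in> {..<n}. c j i \<noteq> c k i})"
      unfolding s2[symmetric] by (intro mult_left_mono) auto
    also have "\<dots> = (\<Sum>i\<in>{i \<in> {..<n}. c j i \<noteq> c k i}. s\<^sup>2)" by simp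
    also have "\<dots> \<le> (\<Sum>i\<in>{i \<in> {..<n}. c j i \<noteq> c k i}. (u j i - u k i)\<^sup>2)"
    proof (rule sum_mono)
      fix i assume "i \<in> {i \<in> {..<n}. c j i \<noteq> c k i}"
      then have "1 \<le> \<bar>real (c j i) - real (c k i)\<bar>" by auto
      then have "1 \<le> (real (c j i) - real (c k i))\<^sup>2"
        using abs_le_square_iff[of 1 "real (c j i) - real (c k i)"] by simp
      then have "s\<^sup>2 * 1 \<le> s\<^sup>2 * (real (c j i) - real (c k i))\<^sup>2"
        by (intro mult_left_mono) auto
      also have "\<dots> = (u j i - u k i)\<^sup>2"
        by (simp add: u_def power_mult_distrib flip: right_diff_distrib)
      finally show "s\<^sup>2 \<le> (u j i - u k i)\<^sup>2" by simp
    qed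
    also have "\<dots> \<le> (\<Sum>i<n. (u j i - u k i)\<^sup>2)"
      by (intro sum_mono2) auto
    finally have m: "2 * t \<le> (\<Sum>i<n. (u j i - u k i)\<^sup>2)" .
    \<comment> \<open>By \<open>m\<close> the mean is at least \<open>2 * t\<close>, so a statistic
      below \<open>t\<close> has deviated by more than \<open>t\<close>.\<close>
    have "measure_pmf.prob ?p (D k) \<le> measure_pmf.prob ?p
        {y. t \<le> \<bar>(\<Sum>i<n. (real (y i) - u k i)\<^sup>2 - real (y i)) - (\<Sum>i<n. (u j i - u k i)\<^sup>2)\<bar>}"
      by (rule measure_pmf.finite_measure_mono) (use m in \<open>auto simp: D_def\<close>)
    also have "\<dots> \<le> l"
      using u[OF jk(1)] u[OF jk(2)] \<open>0 < t\<close> by (intro dev) auto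
    finally show "measure_pmf.prob ?p (D k) \<le> l2" using assms(6) by simp
  qed
  then show ?thesis
    using Ccard by (intro exI conjI) simp_all
qed

lemma liminf_DI_rate_ge_eps:
  assumes "0 < E" "0 < l1" "0 < l2" "0 < \<epsilon>" "\<epsilon> < 1"
  shows "ereal ((1 - \<epsilon>) / 4) \<le> liminf (DI_rate E l1 l2)"
proof -
  define l where "l = min l1 l2"
  define K where "K = sqrt ((3 + 2 * E\<^sup>2)\<^sup>2 * exp (E * (exp 2 - 1)) / l)"
  \<comment> \<open>The mesh, of order \<open>n powr (-1/4)\<close>; hence the alphabet size
    \<open>E / a n\<close> grows like \<open>n powr (1/4)\<close>, the origin of the factor
    1/4.\<close>
  define a where "a n = sqrt (2 * K / (\<epsilon> * sqrt (real n)))" for n :: nat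
  define g where "g n = ((1 - \<epsilon>) * log 2 (E / a n - 1) - 1) / log 2 (real n)" for n :: nat
  have "0 < l" using assms by (simp add: l_def)
  have "0 < K"
    unfolding K_def using \<open>0 < l\<close>
    by (intro real_sqrt_gt_zero divide_pos_pos mult_pos_pos zero_less_power add_pos_nonneg) auto
  \<comment> \<open>Makes the rounded alphabet size positive and keeps the argument
    \<open>E / a n - 1\<close> of the logarithm in \<open>g\<close> above 1.\<close>
  have "\<forall>\<^sub>F n in sequentially. E / a n > 2"
    unfolding a_def using assms \<open>0 < K\<close> by real_asymp
  then have "\<forall>\<^sub>F n in sequentially. ereal (g n) \<le> DI_rate E l1 l2 n"
    using eventually_ge_at_top[of 2]
  proof eventually_elim
    case (elim n)
    define q where "q = nat \<lfloor>E / a n\<rfloor>"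
    have "0 < a n" using elim assms \<open>0 < K\<close> by (simp add: a_def)
    have q: "0 < q" "q \<le> E / a n" "E / a n - 1 \<le> q"
      unfolding q_def using elim by (linarith | simp)+
    have "real q * a n \<le> E"
      using q(2) \<open>0 < a n\<close> by (simp add: pos_le_divide_eq)
    then have "\<exists>N u D. is_DI_code E n N l1 l2 u D \<and> real q ^ n \<le> N * (2 ^ n * q powr (\<epsilon> * n))"
      unfolding a_def K_def using assms elim(2) q(1) \<open>0 < l\<close>
      by (intro DI_code_exists[of E l]) (simp_all add: l_def)
    then obtain N u D where code: "is_DI_code E n N l1 l2 u D"
        and N: "real q ^ n \<le> N * (2 ^ n * q powr (\<epsilon> * n))"
      by (elim exE conjE)
    \<comment> \<open>The Gilbert-Varshamov count per symbol: \<open>B ^ n\<close> is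
      \<open>q ^ n\<close> divided by the ball bound
      \<open>2 ^ n * q powr (\<epsilon> * n)\<close>.\<close>
    define B where "B = real q powr (1 - \<epsilon>) / 2"
    have "B ^ n * (2 ^ n * q powr (\<epsilon> * n)) = q powr ((1 - \<epsilon>) * n) * q powr (\<epsilon> * n)"
      using q(1) by (simp add: B_def power_divide powr_power mult.commute)
    also have "\<dots> = q powr n"
      by (simp add: algebra_simps flip: powr_add)
    also have "\<dots> = real q ^ n"
      using q(1) by (simp add: powr_realpow)
    finally have "B ^ n * (2 ^ n * q powr (\<epsilon> * n)) \<le> N * (2 ^ n * q powr (\<epsilon> * n))"
      using N by simp
    then have "B ^ n \<le> N"
      by (rule mult_right_le_imp_le) (use q(1) in simp)
    then have "ereal (B ^ n) \<le> ereal N" by simp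
    also have "\<dots> \<le> N_DI E n l1 l2"
      unfolding N_DI_def using code by (intro Sup_upper) auto
    finally have "ereal (log 2 (B ^ n)) \<le> elog2 (N_DI E n l1 l2)"
      using q(1) by (intro elog2_ge) (auto simp: B_def)
    then have "ereal (log 2 (B ^ n)) * ereal (1 / (real n * log 2 (real n))) \<le> DI_rate E l1 l2 n"
      unfolding DI_rate_def using elim by (intro ereal_mult_right_mono) auto
    moreover have "log 2 (B ^ n) = n * ((1 - \<epsilon>) * log 2 q - 1)"
      using q(1) by (simp add: B_def log_nat_power log_divide log_powr)
    ultimately have "ereal (((1 - \<epsilon>) * log 2 q - 1) / log 2 n) \<le> DI_rate E l1 l2 n"
      using elim by simp
    moreover have "g n \<le> ((1 - \<epsilon>) * log 2 q - 1) / log 2 n"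
      unfolding g_def using elim q assms
      by (intro divide_right_mono diff_right_mono mult_left_mono log_mono) auto
    ultimately show ?case
      by (meson ereal_less_eq(3) order_trans)
  qed
  then have "liminf (\<lambda>n. ereal (g n)) \<le> liminf (DI_rate E l1 l2)"
    by (rule Liminf_mono)
  moreover have "g \<longlonglongrightarrow> (1 - \<epsilon>) / 4"
    unfolding g_def a_def using assms \<open>0 < K\<close> by real_asymp
  then have "liminf (\<lambda>n. ereal (g n)) = ereal ((1 - \<epsilon>) / 4)"
    by (intro lim_imp_Liminf) auto
  ultimately show ?thesis by simp
qed

lemma liminf_DI_rate_ge:
  assumes "0 < E" "0 < l1" "0 < l2"
  shows "ereal (1/4) \<le> liminf (DI_rate E l1 l2)"
proof (rule ccontr)
  assume "\<not> ereal (1/4) \<le> liminf (DI_rate E l1 l2)"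
  then have "liminf (DI_rate E l1 l2) < ereal (1/4)" by (simp add: not_le)
  from ereal_dense2[OF this]
  obtain m where m: "liminf (DI_rate E l1 l2) < ereal m" "ereal m < ereal (1/4)"
    by (elim exE conjE)
  \<comment> \<open>Makes \<open>(1 - \<epsilon>) / 4 = max m (1/8)\<close>, which is at least
    \<open>m\<close>; the maximum keeps \<open>\<epsilon>\<close> below 1 even when \<open>m\<close>
    is small or negative.\<close>
  define \<epsilon> where "\<epsilon> = 1 - 4 * max m (1/8)"
  have "ereal ((1 - \<epsilon>) / 4) \<le> liminf (DI_rate E l1 l2)"
    using assms m(2) by (intro liminf_DI_rate_ge_eps) (simp_all add: \<epsilon>_def)
  also have "\<dots> < ereal m" by (rule m)
  finally show False by (simp add: \<epsilon>_def)
qed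

theorem theorem5:
  fixes E l1 l2 :: real
  assumes "0 < E" and "0 < l1" and "0 < l2" and "l1 + l2 < 1"
  shows "ereal (1/4) \<le> C_DI_dot E \<and>
         C_DI_dot E \<le> limsup (DI_rate E l1 l2) \<and>
         limsup (DI_rate E l1 l2) \<le> ereal (1/2)"
proof (intro conjI)
  \<comment> \<open>The infimum ranges over every positive error pair, so the lower bound must also
    cover pairs whose sum is large.\<close>
  show "ereal (1/4) \<le> C_DI_dot E"
    unfolding C_DI_dot_def using assms(1) by (intro INF_greatest liminf_DI_rate_ge) auto
  have "C_DI_dot E \<le> liminf (DI_rate E l1 l2)"
    unfolding C_DI_dot_def by (rule INF_lower2[of "(l1, l2)"]) (use assms in auto)
  also have "\<dots> \<le> limsup (DI_rate E l1 l2)"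
    by (intro Liminf_le_Limsup) simp
  finally show "C_DI_dot E \<le> limsup (DI_rate E l1 l2)" .
  show "limsup (DI_rate E l1 l2) \<le> ereal (1/2)"
    by (rule limsup_DI_rate_le[OF assms(1,4)])
qed

end
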